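(* Let $\kappa=1/2$ and $c\ge0$ with $c\ne\sqrt2$. For $j\ge1$ an odd integer, set $I_j=(-j\pi/\sqrt2,\,j\pi/\sqrt2)$. If $c=0$, define $u^{(j)}_{c,1/2}(x)=\sin(x/\sqrt2)$ for all $x\in I_j$; if $c>0$ (with $c\neq\sqrt2$), define for all $x\in I_j$ $$u^{(j)}_{c,1/2}(x)=\sqrt{1-\frac{2-c^2}{2}\cos^2\Big(\frac{x}{\sqrt2}\Big)}\;e^{i\theta(x)},\qquad \theta(y)=\frac\pi2+k\pi-\frac{cy}2-\arctan\Big(\frac{c}{\sqrt2}\cot\Big(\frac{y}{\sqrt2}\Big)\Big)$$ for $y\in(k\sqrt2\pi,(k+1)\sqrt2\pi)\cap I_j$, for all $k\in\mathbb{Z}$ (extended by continuity to the points $k\sqrt2\pi\in I_j$). In both cases, extend $u^{(j)}_{c,1/2}$ to $\mathbb{R}$ as a continuous function which is constant on each connected component of $\mathbb{R}\setminus I_j$. Then $u^{(j)}_{c,1/2}\in\mathcal{X}(\mathbb{R})$ and it is a weak solution to $\mathrm{TW}(c,1/2)$.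
   Context: For $z_1,z_2\in\mathbb{C}$, $\langle z_1,z_2\rangle=\operatorname{Re}(z_1\overline{z_2})$. Energy space: $\mathcal{X}(\mathbb{R})=\{v\in H^1_{\mathrm{loc}}(\mathbb{R};\mathbb{C}): 1-|v|^2\in L^2(\mathbb{R}),\ v'\in L^2(\mathbb{R})\}$. $\mathrm{TW}(c,\kappa)$ is the equation $icu'+u''+u(1-|u|^2)+\kappa u(1-|u|^2)''=0$. A function $u\in\mathcal{X}(\mathbb{R})$ is a weak solution if for all $\phi\in C_0^\infty(\mathbb{R};\mathbb{C})$, $$\int_{\mathbb{R}}\langle icu'+u(1-|u|^2),\phi\rangle-\langle u',\phi'\rangle+2\kappa\langle u,u'\rangle\langle u,\phi\rangle'=0.$$ *)

theory Defs
  imports "HOL-Analysis.Analysis"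
begin

text \<open>The pairing \<open>\<langle>z\<^sub>1, z\<^sub>2\<rangle> = Re (z\<^sub>1 * cnj z\<^sub>2)\<close> is the library's real inner product on \<^typ>\<open>complex\<close>.\<close>

lemma inner_complex_eq_Re_mult_cnj: "z\<^sub>1 \<bullet> z\<^sub>2 = Re (z\<^sub>1 * cnj z\<^sub>2)"
  for z\<^sub>1 z\<^sub>2 :: complex
  by (simp add: inner_complex_def)

subsection \<open>Test functions, weak derivatives, and the energy space\<close>

definition smooth :: "(real \<Rightarrow> 'a::real_normed_vector) \<Rightarrow> bool" where
  "smooth \<phi> \<longleftrightarrow>
     (\<forall>n x. ((\<lambda>f y. vector_derivative f (at y)) ^^ n) \<phi> differentiable (at x))"

definition test_function :: "(real \<Rightarrow> 'a::real_normed_vector) \<Rightarrow> bool" where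
  "test_function \<phi> \<longleftrightarrow> smooth \<phi> \<and> compact (closure {x. \<phi> x \<noteq> 0})"

definition square_integrable ::
    "(real \<Rightarrow> 'a::{banach, second_countable_topology}) \<Rightarrow> bool" where
  "square_integrable f \<longleftrightarrow>
     f \<in> borel_measurable lebesgue \<and> integrable lebesgue (\<lambda>x. (norm (f x))\<^sup>2)"

definition locally_integrable ::
    "(real \<Rightarrow> 'a::{banach, second_countable_topology}) \<Rightarrow> bool" where
  "locally_integrable f \<longleftrightarrow> (\<forall>K. compact K \<longrightarrow> set_integrable lebesgue K f)"

definition locally_square_integrable ::
    "(real \<Rightarrow> 'a::{banach, second_countable_topology}) \<Rightarrow> bool" where
  "locally_square_integrable f \<longleftrightarrow>
     f \<in> borel_measurable lebesgue \<and>
     (\<forall>K. compact K \<longrightarrow> set_integrable lebesgue K (\<lambda>x. (norm (f x))\<^sup>2))"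

text \<open>A weak derivative is unique only up to a null set, so it is treated as a relation; none
  of the notions below depends on which representative is taken.  Both integrals converge
  because \<open>\<phi>\<close> and \<open>\<phi>'\<close> are bounded with compact support.  Real-valued test
  functions suffice, also for complex-valued \<open>v\<close>, by linearity.\<close>

definition has_weak_derivative ::
    "(real \<Rightarrow> 'a::{banach, second_countable_topology}) \<Rightarrow> (real \<Rightarrow> 'a) \<Rightarrow> bool" where
  "has_weak_derivative v w \<longleftrightarrow>
     locally_integrable v \<and> locally_integrable w \<and>
     (\<forall>\<phi> :: real \<Rightarrow> real. test_function \<phi> \<longrightarrow>
        (\<integral>x. vector_derivative \<phi> (at x) *\<^sub>R v x \<partial>lebesgue) =
        - (\<integral>x. \<phi> x *\<^sub>R w x \<partial>lebesgue))"

definition H1_loc :: "(real \<Rightarrow> complex) set" where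
  "H1_loc = {v. locally_square_integrable v \<and>
     (\<exists>v'. has_weak_derivative v v' \<and> locally_square_integrable v')}"

definition energy_space :: "(real \<Rightarrow> complex) set" where
  "energy_space = {v \<in> H1_loc. square_integrable (\<lambda>x. 1 - (norm (v x))\<^sup>2) \<and>
     (\<exists>v'. has_weak_derivative v v' \<and> square_integrable v')}"

subsection \<open>Weak solutions of \<open>TW(c, \<kappa>)\<close>\<close>

text \<open>Here \<open>u'\<close> stands for the weak derivative of \<open>u\<close> and \<open>d\<close> for that of
  \<open>\<langle>u, \<phi>\<rangle>\<close>.  The integrand is integrable for every \<open>u\<close> in the energy space; using
  \<^const>\<open>has_bochner_integral\<close> makes this explicit and excludes the default value \<open>0\<close>
  of a non-convergent integral.\<close>

definition weak_solution_TW :: "real \<Rightarrow> real \<Rightarrow> (real \<Rightarrow> complex) \<Rightarrow> bool" where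
  "weak_solution_TW c \<kappa> u \<longleftrightarrow> u \<in> energy_space \<and>
     (\<exists>u'. has_weak_derivative u u' \<and>
       (\<forall>\<phi> :: real \<Rightarrow> complex. test_function \<phi> \<longrightarrow>
         (\<exists>d. has_weak_derivative (\<lambda>x. u x \<bullet> \<phi> x) d \<and>
            has_bochner_integral lebesgue
              (\<lambda>x. (\<i> * of_real c * u' x + u x * of_real (1 - (norm (u x))\<^sup>2)) \<bullet> \<phi> x
                   - u' x \<bullet> vector_derivative \<phi> (at x)
                   + 2 * \<kappa> * (u x \<bullet> u' x) * d x)
              0)))"

subsection \<open>The functions \<open>u\<^sup>(\<^sup>j\<^sup>)\<close> for \<open>\<kappa> = 1/2\<close>\<close>

definition I :: "nat \<Rightarrow> real set" where
  "I j = {- (real j * pi / sqrt 2) <..< real j * pi / sqrt 2}"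

definition is_phase :: "real \<Rightarrow> nat \<Rightarrow> (real \<Rightarrow> real) \<Rightarrow> bool" where
  "is_phase c j \<theta> \<longleftrightarrow> continuous_on (I j) \<theta> \<and>
     (\<forall>k :: int. \<forall>y \<in> {of_int k * sqrt 2 * pi <..< (of_int k + 1) * sqrt 2 * pi} \<inter> I j.
        \<theta> y = pi / 2 + of_int k * pi - c * y / 2
                 - arctan (c / sqrt 2 * cot (y / sqrt 2)))"

definition is_profile :: "real \<Rightarrow> nat \<Rightarrow> (real \<Rightarrow> complex) \<Rightarrow> bool" where
  "is_profile c j u \<longleftrightarrow>
     (if c = 0 then \<forall>x \<in> I j. u x = of_real (sin (x / sqrt 2))
      else \<exists>\<theta>. is_phase c j \<theta> \<and>
        (\<forall>x \<in> I j. u x = of_real (sqrt (1 - (2 - c\<^sup>2) / 2 * (cos (x / sqrt 2))\<^sup>2))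
                           * exp (\<i> * of_real (\<theta> x)))) \<and>
     continuous_on UNIV u \<and>
     (\<forall>S \<in> components (- I j). u constant_on S)"

text \<open>For odd \<open>j\<close> and \<open>c \<ge> 0\<close> there is exactly one such function: the one-sided limits of
  \<open>\<theta>\<close> agree at the points \<open>k * sqrt 2 * pi\<close>, and the formulas on \<open>I j\<close> extend
  continuously to its end points.\<close>

definition profile :: "real \<Rightarrow> nat \<Rightarrow> real \<Rightarrow> complex" where
  "profile c j = (THE u. is_profile c j u)"

end

theory Submission
  imports Defs
begin

text \<open>
  With \<open>s = x / sqrt 2\<close> the polar form collapses to
  \<open>(c / sqrt 2 * cos s + \<i> sin s) e\<^bsup>-\<i>cx/2\<^esup>\<close> (times \<open>-\<i>\<close> if \<open>c = 0\<close>), which is smooth on the whole line.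
  Its derivative, \<open>1 - |u|\<^sup>2\<close> and \<open>\<langle>u, u'\<rangle>\<close> are all multiples of \<open>cos s\<close>, so they vanish at the
  end points of \<open>I j\<close>, because \<open>j\<close> is odd.  Hence freezing the function outside \<open>I j\<close> yields a \<open>C\<^sup>1\<close>
  function, and the integrand of the weak equation is zero outside \<open>I j\<close>, while on \<open>I j\<close> it is the
  derivative of \<open>\<langle>u, u'\<rangle>\<langle>u, \<phi>\<rangle> - \<langle>u', \<phi>\<rangle>\<close>, which vanishes at both ends.
\<close>

subsection \<open>Continuously differentiable functions and their weak derivatives\<close>

lemma indicator_scaleR_support:
  fixes f :: "'a \<Rightarrow> 'b::real_vector"
  assumes "\<And>x. x \<notin> K \<Longrightarrow> f x = 0"
  shows "(\<lambda>x. indicator K x *\<^sub>R f x) = f"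
proof
  show "indicator K x *\<^sub>R f x = f x" for x
    using assms[of x] by (cases "x \<in> K") simp_all
qed

text \<open>Passing from \<open>lborel\<close> to its completion \<open>lebesgue\<close> does not
  affect integrability of Borel measurable functions, so the Borel statement carries over.\<close>

lemma set_integrable_lebesgue_continuous_on_compact:
  fixes f :: "real \<Rightarrow> 'a::euclidean_space"
  assumes "compact K" "continuous_on K f"
  shows "set_integrable lebesgue K f"
  unfolding set_integrable_def
    integrable_completion[OF borel_measurable_integrable[OF borel_integrable_compact[OF assms]]]
  by (rule borel_integrable_compact[OF assms])

lemma continuous_imp_borel_measurable_lebesgue:
  fixes f :: "real \<Rightarrow> 'a::euclidean_space"
  assumes "continuous_on UNIV f"
  shows "f \<in> borel_measurable lebesgue"
  by (rule measurable_completion) (simp add: borel_measurable_continuous_onI[OF assms])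

lemma locally_integrable_continuous:
  fixes f :: "real \<Rightarrow> 'a::euclidean_space"
  assumes "continuous_on UNIV f"
  shows "locally_integrable f"
  unfolding locally_integrable_def
  by (intro allI impI set_integrable_lebesgue_continuous_on_compact continuous_on_subset[OF assms])
    auto

lemma locally_square_integrable_continuous:
  fixes f :: "real \<Rightarrow> 'a::euclidean_space"
  assumes "continuous_on UNIV f"
  shows "locally_square_integrable f"
  unfolding locally_square_integrable_def
proof (intro conjI allI impI)
  show "f \<in> borel_measurable lebesgue"
    by (rule continuous_imp_borel_measurable_lebesgue[OF assms])
  fix K :: "real set" assume "compact K"
  moreover have "continuous_on K (\<lambda>x. (norm (f x))\<^sup>2)"
    by (intro continuous_intros continuous_on_subset[OF assms]) auto
  ultimately show "set_integrable lebesgue K (\<lambda>x. (norm (f x))\<^sup>2)"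
    by (rule set_integrable_lebesgue_continuous_on_compact)
qed

lemma square_integrable_continuous_compact_support:
  fixes f :: "real \<Rightarrow> 'a::euclidean_space"
  assumes "continuous_on UNIV f" "compact K" "\<And>x. x \<notin> K \<Longrightarrow> f x = 0"
  shows "square_integrable f"
proof -
  have "set_integrable lebesgue K (\<lambda>x. (norm (f x))\<^sup>2)"
    using locally_square_integrable_continuous[OF assms(1)] assms(2)
    by (simp add: locally_square_integrable_def)
  then have "integrable lebesgue (\<lambda>x. (norm (f x))\<^sup>2)"
    unfolding set_integrable_def by (subst (asm) indicator_scaleR_support) (simp_all add: assms(3))
  then show ?thesis
    using continuous_imp_borel_measurable_lebesgue[OF assms(1)]
    by (simp add: square_integrable_def)
qed

text \<open>Borel measurability of the integrand lets both integrability and the value of the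
  integral pass from \<open>lborel\<close> to its completion.\<close>

lemma has_bochner_integral_lebesgue_FTC_Icc:
  fixes F f :: "real \<Rightarrow> 'a::euclidean_space"
  assumes "a \<le> b" "\<And>x. (F has_vector_derivative f x) (at x)" "continuous_on {a..b} f"
  shows "has_bochner_integral lebesgue (\<lambda>x. indicator {a..b} x *\<^sub>R f x) (F b - F a)"
proof -
  have *: "has_bochner_integral lborel (\<lambda>x. indicator {a..b} x *\<^sub>R f x) (F b - F a)"
    using assms(1,3) has_vector_derivative_at_within[OF assms(2)]
    by (intro has_bochner_integral_FTC_Icc)
  then have "(\<lambda>x. indicator {a..b} x *\<^sub>R f x) \<in> borel_measurable lborel"
    by (auto dest: borel_measurable_has_bochner_integral)
  with * show ?thesis
    by (simp add: has_bochner_integral_iff integrable_completion integral_completion)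
qed

lemma test_functionD:
  assumes "test_function \<phi>"
  shows test_function_has_vector_derivative:
      "(\<phi> has_vector_derivative vector_derivative \<phi> (at x)) (at x)"
    and test_function_continuous: "continuous_on S \<phi>"
    and test_function_continuous_derivative:
      "continuous_on S (\<lambda>x. vector_derivative \<phi> (at x))"
proof -
  have "\<And>n x. ((\<lambda>f y. vector_derivative f (at y)) ^^ n) \<phi> differentiable (at x)"
    using assms by (simp add: test_function_def smooth_def)
  \<comment> \<open>Orders 0 and 1 of smoothness: \<open>\<phi>\<close> and its derivative are both
    differentiable, hence continuous.\<close>
  from this[of 0] this[of 1]
  have *: "\<And>x. \<phi> differentiable (at x)"
    "\<And>x. (\<lambda>x. vector_derivative \<phi> (at x)) differentiable (at x)"
    by simp_all
  show "(\<phi> has_vector_derivative vector_derivative \<phi> (at x)) (at x)"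
    using *(1) vector_derivative_works by blast
  show "continuous_on S \<phi>" "continuous_on S (\<lambda>x. vector_derivative \<phi> (at x))"
    using * differentiable_imp_continuous_within
    by (metis continuous_at_imp_continuous_on)+
qed

lemma test_function_support:
  fixes \<phi> :: "real \<Rightarrow> 'a::real_normed_vector"
  assumes "test_function \<phi>"
  obtains M where "M > 0" "\<And>x. \<bar>x\<bar> \<ge> M \<Longrightarrow> \<phi> x = 0"
    "\<And>x. \<bar>x\<bar> \<ge> M \<Longrightarrow> vector_derivative \<phi> (at x) = 0"
proof -
  let ?S = "closure {x. \<phi> x \<noteq> 0}"
  have "bounded ?S"
    using assms compact_imp_bounded by (auto simp: test_function_def)
  \<comment> \<open>The bound is strict, so the points \<open>M\<close> and \<open>-M\<close>
    themselves lie off the support and can serve as ends of integration.\<close>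
  then obtain M where M: "M > 0" "\<And>x. x \<in> ?S \<Longrightarrow> \<bar>x\<bar> < M"
    using bounded_pos_less[of ?S] by auto
  have out: "x \<notin> ?S" if "\<bar>x\<bar> \<ge> M" for x
    using M(2)[of x] that by force
  have zero: "\<phi> x = 0" if "x \<notin> ?S" for x
    using that subsetD[OF closure_subset, of x "{x. \<phi> x \<noteq> 0}"] by blast
  have deriv: "vector_derivative \<phi> (at x) = 0" if "\<bar>x\<bar> \<ge> M" for x
  proof -
    \<comment> \<open>The complement of the closed support is open, so \<open>\<phi>\<close>
      vanishes on a whole neighbourhood of \<open>x\<close>.\<close>
    have "(\<phi> has_vector_derivative 0) (at x)"
    proof (rule has_vector_derivative_transform_within_open)
      show "((\<lambda>x. 0) has_vector_derivative 0) (at x)"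
        by (rule has_vector_derivative_const)
      show "open (- ?S)"
        by (rule open_Compl[OF closed_closure])
      show "x \<in> - ?S"
        using out[OF that] by blast
      show "0 = \<phi> y" if "y \<in> - ?S" for y
        using zero[of y] that by (metis ComplD)
    qed
    then show ?thesis
      by (rule vector_derivative_at)
  qed
  show ?thesis
    by (rule that[OF M(1) zero[OF out] deriv])
qed

text \<open>Integration by parts on an interval containing the support of the test function, which
  vanishes at both ends and so leaves no boundary term.\<close>

lemma has_weak_derivative_C1:
  fixes v w :: "real \<Rightarrow> 'a::euclidean_space"
  assumes v: "\<And>x. (v has_vector_derivative w x) (at x)" and w: "continuous_on UNIV w"
  shows "has_weak_derivative v w"
  unfolding has_weak_derivative_def
proof (intro conjI allI impI)
  have cv: "continuous_on UNIV v"
    using v has_vector_derivative_continuous by (metis continuous_at_imp_continuous_on)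
  show "locally_integrable v" "locally_integrable w"
    using cv w by (simp_all add: locally_integrable_continuous)
  fix \<phi> :: "real \<Rightarrow> real" assume tf: "test_function \<phi>"
  let ?d = "\<lambda>x. vector_derivative \<phi> (at x)"
  obtain M where M: "M > 0" "\<And>x. \<bar>x\<bar> \<ge> M \<Longrightarrow> \<phi> x = 0" "\<And>x. \<bar>x\<bar> \<ge> M \<Longrightarrow> ?d x = 0"
    using test_function_support[OF tf] by metis
  have cont: "continuous_on S (\<lambda>x. ?d x *\<^sub>R v x)" "continuous_on S (\<lambda>x. \<phi> x *\<^sub>R w x)" for S
    using continuous_on_subset[OF cv] continuous_on_subset[OF w]
      test_function_continuous[OF tf] test_function_continuous_derivative[OF tf]
    by (auto intro!: continuous_on_scaleR)
  have int: "integrable lebesgue (\<lambda>x. ?d x *\<^sub>R v x)" "integrable lebesgue (\<lambda>x. \<phi> x *\<^sub>R w x)"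
    using set_integrable_lebesgue_continuous_on_compact[OF compact_Icc cont(1), of "-M" M]
      set_integrable_lebesgue_continuous_on_compact[OF compact_Icc cont(2), of "-M" M]
    unfolding set_integrable_def
    by (subst (asm) (1 2) indicator_scaleR_support; use M in force)+
  have "((\<lambda>x. \<phi> x *\<^sub>R v x) has_vector_derivative (\<phi> x *\<^sub>R w x + ?d x *\<^sub>R v x)) (at x)" for x
    using test_function_has_vector_derivative[OF tf] v
    by (auto intro!: has_vector_derivative_scaleR simp: has_real_derivative_iff_has_vector_derivative)
  then have "has_bochner_integral lebesgue
      (\<lambda>x. indicator {-M..M} x *\<^sub>R (\<phi> x *\<^sub>R w x + ?d x *\<^sub>R v x)) (\<phi> M *\<^sub>R v M - \<phi> (-M) *\<^sub>R v (-M))"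
    using M(1) by (intro has_bochner_integral_lebesgue_FTC_Icc continuous_on_add cont) auto
  also have "(\<lambda>x. indicator {-M..M} x *\<^sub>R (\<phi> x *\<^sub>R w x + ?d x *\<^sub>R v x)) =
      (\<lambda>x. \<phi> x *\<^sub>R w x + ?d x *\<^sub>R v x)"
    by (rule indicator_scaleR_support) (use M in force)
  also have "\<phi> M *\<^sub>R v M - \<phi> (-M) *\<^sub>R v (-M) = 0"
    using M(1,2) by simp
  finally have "has_bochner_integral lebesgue (\<lambda>x. \<phi> x *\<^sub>R w x + ?d x *\<^sub>R v x) 0" .
  with int show "(\<integral>x. ?d x *\<^sub>R v x \<partial>lebesgue) = - (\<integral>x. \<phi> x *\<^sub>R w x \<partial>lebesgue)"
    by (simp add: has_bochner_integral_iff eq_neg_iff_add_eq_0 add.commute)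
qed

section \<open>Freezing a function beyond the ends of an interval\<close>

lemma has_vector_derivative_min:
  fixes f :: "real \<Rightarrow> 'a::real_normed_vector"
  assumes f: "\<And>x. (f has_vector_derivative f' x) (at x)" and zero: "f' b = 0"
  shows "((\<lambda>x. f (min b x)) has_vector_derivative f' (min b x)) (at x)"
proof -
  \<comment> \<open>The constant piece has slope 0, so \<open>f' b = 0\<close> is exactly what makes
    the one-sided derivatives agree at \<open>b\<close>.\<close>
  have "((\<lambda>x. if x \<in> {..b} then f x else f b) has_vector_derivative
      (if x \<in> {..b} then f' x else 0)) (at x within UNIV)"
    by (rule has_vector_derivative_If_within_closures[where T = "{b..}"])
      (use zero in \<open>auto intro: has_vector_derivative_at_within f\<close>)
  also have "(\<lambda>x. if x \<in> {..b} then f x else f b) = (\<lambda>x. f (min b x))"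
    by (auto simp: min_def)
  also have "(if x \<in> {..b} then f' x else 0) = f' (min b x)"
    using zero by (auto simp: min_def)
  finally show ?thesis .
qed

lemma has_vector_derivative_max:
  fixes f :: "real \<Rightarrow> 'a::real_normed_vector"
  assumes f: "\<And>x. (f has_vector_derivative f' x) (at x)" and zero: "f' a = 0"
  shows "((\<lambda>x. f (max a x)) has_vector_derivative f' (max a x)) (at x)"
proof -
  have "((\<lambda>x. if x \<in> {a..} then f x else f a) has_vector_derivative
      (if x \<in> {a..} then f' x else 0)) (at x within UNIV)"
    by (rule has_vector_derivative_If_within_closures[where T = "{..a}"])
      (use zero in \<open>auto intro: has_vector_derivative_at_within f\<close>)
  also have "(\<lambda>x. if x \<in> {a..} then f x else f a) = (\<lambda>x. f (max a x))"
    by (auto simp: max_def)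
  also have "(if x \<in> {a..} then f' x else 0) = f' (max a x)"
    using zero by (auto simp: max_def)
  finally show ?thesis .
qed

text \<open>Composition with this projection onto \<open>{-R..R}\<close> (for
  \<open>R \<ge> 0\<close>) expresses extension by the end values in one formula, without case
  distinctions.\<close>

definition clamp_to :: "real \<Rightarrow> real \<Rightarrow> real" where
  "clamp_to R x = min R (max (-R) x)"

lemma clamp_to_eq [simp]: "x \<in> {-R..R} \<Longrightarrow> clamp_to R x = x"
  and clamp_to_left: "x \<le> -R \<Longrightarrow> R \<ge> 0 \<Longrightarrow> clamp_to R x = -R"
  and clamp_to_right: "x \<ge> R \<Longrightarrow> R \<ge> 0 \<Longrightarrow> clamp_to R x = R"
  by (auto simp: clamp_to_def)

lemma continuous_on_clamp_to [continuous_intros]: "continuous_on S (clamp_to R)"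
  unfolding clamp_to_def by (intro continuous_intros)

lemma has_vector_derivative_clamp_to:
  fixes f :: "real \<Rightarrow> 'a::real_normed_vector"
  assumes "R \<ge> 0" "\<And>x. (f has_vector_derivative f' x) (at x)" "f' R = 0" "f' (-R) = 0"
  shows "((\<lambda>x. f (clamp_to R x)) has_vector_derivative f' (clamp_to R x)) (at x)"
  unfolding clamp_to_def
  using assms
  \<comment> \<open>The freeze at \<open>-R\<close> is applied to the function already frozen at
    \<open>R\<close>; \<open>R \<ge> 0\<close> gives \<open>min R (-R) = -R\<close>, so the slope
    there is still 0.\<close>
  by (intro has_vector_derivative_max[where f = "\<lambda>x. f (min R x)" and f' = "\<lambda>x. f' (min R x)"]
      has_vector_derivative_min) (auto simp: min_def)

subsection \<open>The wave in closed form\<close>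

lemma sqrt2_mult: "sqrt 2 * (sqrt 2 * x) = 2 * x"
  by (simp flip: mult.assoc)

text \<open>The constant phase \<open>\<epsilon>\<close> is later set to 1 for \<open>c > 0\<close>
  and to \<open>-\<i>\<close> for \<open>c = 0\<close>, so that both cases share one
  formula.\<close>

definition wave :: "complex \<Rightarrow> real \<Rightarrow> real \<Rightarrow> complex" where
  "wave \<epsilon> c x = \<epsilon> * exp (- (\<i> * of_real (c * x / 2))) *
     Complex (c / sqrt 2 * cos (x / sqrt 2)) (sin (x / sqrt 2))"

definition wave' :: "complex \<Rightarrow> real \<Rightarrow> real \<Rightarrow> complex" where
  "wave' \<epsilon> c x = \<epsilon> * exp (- (\<i> * of_real (c * x / 2))) *
     Complex 0 ((2 - c\<^sup>2) / 2 / sqrt 2 * cos (x / sqrt 2))"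

lemma has_vector_derivative_Complex:
  assumes "(f has_real_derivative f') (at x)" "(g has_real_derivative g') (at x)"
  shows "((\<lambda>x. Complex (f x) (g x)) has_vector_derivative Complex f' g') (at x)"
proof -
  have "((\<lambda>x. of_real (f x) + \<i> * of_real (g x)) has_vector_derivative
      (of_real f' + \<i> * of_real g' :: complex)) (at x)"
    using assms
    by (auto intro!: derivative_eq_intros has_vector_derivative_of_real
        simp: has_real_derivative_iff_has_vector_derivative)
  then show ?thesis by (simp add: Complex_eq)
qed

lemma has_vector_derivative_carrier:
  "((\<lambda>x. \<epsilon> * exp (- (\<i> * of_real (c * x / 2)))) has_vector_derivative
     \<epsilon> * exp (- (\<i> * of_real (c * x / 2))) * Complex 0 (- (c / 2))) (at x)"
proof -
  have "((\<lambda>z. \<epsilon> * exp (- (\<i> * (of_real c * z / 2)))) has_field_derivative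
     \<epsilon> * exp (- (\<i> * (of_real c * of_real x / 2))) * Complex 0 (- (c / 2))) (at (of_real x))"
    by (auto intro!: derivative_eq_intros simp: Complex_eq)
  from has_vector_derivative_real_field[OF this] show ?thesis by simp
qed

text \<open>Product rule in the rotating frame: differentiating the carrier multiplies it by
  \<open>-\<i> * c / 2\<close>, which mixes the two real components.\<close>

lemma has_vector_derivative_carrier_times:
  assumes "(f has_real_derivative f') (at x)" "(g has_real_derivative g') (at x)"
  shows "((\<lambda>x. \<epsilon> * exp (- (\<i> * of_real (c * x / 2))) * Complex (f x) (g x)) has_vector_derivative
     \<epsilon> * exp (- (\<i> * of_real (c * x / 2))) * Complex (f' + c / 2 * g x) (g' - c / 2 * f x)) (at x)"
proof -
  have "Complex (f' + c / 2 * g x) (g' - c / 2 * f x)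
      = Complex f' g' + Complex 0 (- (c / 2)) * Complex (f x) (g x)"
    by (simp add: complex_eq_iff)
  then show ?thesis
    using has_vector_derivative_mult[OF has_vector_derivative_carrier[of \<epsilon> c x]
        has_vector_derivative_Complex[OF assms]]
    by (simp add: algebra_simps)
qed

text \<open>In the rotating frame the real part cancels: the cosine contributes
  \<open>-c/2 * sin\<close> and the carrier \<open>c/2 * sin\<close>. What remains is a multiple of
  the cosine.\<close>

lemma wave_has_vector_derivative:
  "(wave \<epsilon> c has_vector_derivative wave' \<epsilon> c x) (at x)"
proof -
  have "((\<lambda>x. c / sqrt 2 * cos (x / sqrt 2)) has_real_derivative - (c / 2 * sin (x / sqrt 2))) (at x)"
    by (auto intro!: derivative_eq_intros simp: field_simps)
  moreover have "((\<lambda>x. sin (x / sqrt 2)) has_real_derivative cos (x / sqrt 2) / sqrt 2) (at x)"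
    by (auto intro!: derivative_eq_intros simp: field_simps)
  ultimately show ?thesis
    unfolding wave_def[abs_def] wave'_def
    by (rule has_vector_derivative_carrier_times[THEN has_vector_derivative_eq_rhs])
      (simp add: field_simps power2_eq_square complex_eq_iff)
qed

text \<open>The profile solves a linear equation, because \<open>1 - |u|\<^sup>2 + (1 - |u|\<^sup>2)'' / 2\<close> is the
  constant \<open>(2 - c\<^sup>2) / 4\<close>.\<close>

lemma wave'_has_vector_derivative:
  "(wave' \<epsilon> c has_vector_derivative
     - (\<i> * of_real c * wave' \<epsilon> c x) - of_real ((2 - c\<^sup>2) / 4) * wave \<epsilon> c x) (at x)"
proof -
  let ?e = "\<epsilon> * exp (- (\<i> * of_real (c * x / 2)))"
  let ?b = "(2 - c\<^sup>2) / 2"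
  let ?C = "cos (x / sqrt 2)" and ?S = "sin (x / sqrt 2)"
  have "((\<lambda>x. ?b / sqrt 2 * cos (x / sqrt 2)) has_real_derivative - (?b / 2 * ?S)) (at x)"
    by (auto intro!: derivative_eq_intros simp: field_simps sqrt2_mult)
  from has_vector_derivative_carrier_times[OF DERIV_const[of 0] this, of \<epsilon> c]
  have "(wave' \<epsilon> c has_vector_derivative
      ?e * Complex (c / 2 * (?b / sqrt 2 * ?C)) (- (?b / 2 * ?S))) (at x)"
    unfolding wave'_def[abs_def] by simp
  \<comment> \<open>\<open>Complex 0 c\<close> and \<open>Complex (?b / 2) 0\<close> are the
    coefficients \<open>\<i> * c\<close> and \<open>(2 - c^2) / 4\<close> of the linear equation in
    Cartesian form.\<close>
  moreover have "Complex (c / 2 * (?b / sqrt 2 * ?C)) (- (?b / 2 * ?S))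
     = - (Complex 0 c * Complex 0 (?b / sqrt 2 * ?C)) - Complex (?b / 2) 0 * Complex (c / sqrt 2 * ?C) ?S"
    by (simp add: complex_eq_iff field_simps)
  ultimately have "(wave' \<epsilon> c has_vector_derivative
      ?e * (- (Complex 0 c * Complex 0 (?b / sqrt 2 * ?C)) - Complex (?b / 2) 0 * Complex (c / sqrt 2 * ?C) ?S)) (at x)"
    by simp
  moreover have "?e * (- (Complex 0 c * Complex 0 (?b / sqrt 2 * ?C)) - Complex (?b / 2) 0 * Complex (c / sqrt 2 * ?C) ?S)
     = - (\<i> * of_real c * wave' \<epsilon> c x) - of_real ((2 - c\<^sup>2) / 4) * wave \<epsilon> c x"
    unfolding wave_def wave'_def
    by (simp add: Complex_eq algebra_simps)
  ultimately show ?thesis by simp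
qed

section \<open>Density, momentum and flux of the wave\<close>

lemma inner_mult_unit:
  fixes e z w :: complex
  assumes "norm e = 1"
  shows "(e * z) \<bullet> (e * w) = z \<bullet> w"
proof -
  have "(e * z) * cnj (e * w) = (e * cnj e) * (z * cnj w)"
    by (simp add: mult_ac)
  also have "e * cnj e = 1"
    using assms by (simp add: complex_norm_square[symmetric])
  finally show ?thesis
    by (simp only: inner_complex_eq_Re_mult_cnj mult_1_left)
qed

text \<open>The unimodular factor drops out of norms and inner products, so only real trigonometric
  identities remain.\<close>

lemma
  assumes "norm \<epsilon> = 1"
  shows norm_wave: "1 - (norm (wave \<epsilon> c x))\<^sup>2 = (2 - c\<^sup>2) / 2 * (cos (x / sqrt 2))\<^sup>2"
    and inner_wave_wave': "wave \<epsilon> c x \<bullet> wave' \<epsilon> c x =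
      (2 - c\<^sup>2) / 2 / sqrt 2 * (sin (x / sqrt 2) * cos (x / sqrt 2))"
proof -
  have e: "norm (\<epsilon> * exp (- (\<i> * of_real (c * x / 2)))) = 1"
    using assms by (simp add: norm_mult)
  have "1 - (norm (wave \<epsilon> c x))\<^sup>2 = 1 - ((c / sqrt 2 * cos (x / sqrt 2))\<^sup>2 + (sin (x / sqrt 2))\<^sup>2)"
    unfolding wave_def norm_mult[of "_ * _" "Complex _ _"] e by (simp add: cmod_def)
  also have "\<dots> = (2 - c\<^sup>2) / 2 * (cos (x / sqrt 2))\<^sup>2"
    by (simp add: sin_squared_eq power_mult_distrib power_divide field_simps)
  finally show "1 - (norm (wave \<epsilon> c x))\<^sup>2 = (2 - c\<^sup>2) / 2 * (cos (x / sqrt 2))\<^sup>2" .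
  show "wave \<epsilon> c x \<bullet> wave' \<epsilon> c x =
      (2 - c\<^sup>2) / 2 / sqrt 2 * (sin (x / sqrt 2) * cos (x / sqrt 2))"
    unfolding wave_def wave'_def inner_mult_unit[OF e]
    by (simp add: inner_complex_def field_simps)
qed

lemma continuous_on_wave: "continuous_on S (wave \<epsilon> c)"
  and continuous_on_wave': "continuous_on S (wave' \<epsilon> c)"
  using wave_has_vector_derivative wave'_has_vector_derivative has_vector_derivative_continuous
  by (metis continuous_at_imp_continuous_on)+

text \<open>Let q be the inner product of u and u', and n = 1 - |u|^2. Then q' = n - (2 - c^2)/4,
  and the linear equation gives -u'' = \<i> c u' + (2 - c^2)/4 u. Hence \<i> c u' + n u = q' u -
  u'', and the product rule produces the weak integrand, whose factor 2\<kappa> equals 1.\<close>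

lemma flux_has_vector_derivative:
  assumes "norm \<epsilon> = 1" and \<phi>: "(\<phi> has_vector_derivative d) (at x)"
  shows "((\<lambda>x. (wave \<epsilon> c x \<bullet> wave' \<epsilon> c x) * (wave \<epsilon> c x \<bullet> \<phi> x) - wave' \<epsilon> c x \<bullet> \<phi> x)
    has_vector_derivative
      (\<i> * of_real c * wave' \<epsilon> c x + wave \<epsilon> c x * of_real (1 - (norm (wave \<epsilon> c x))\<^sup>2)) \<bullet> \<phi> x
        - wave' \<epsilon> c x \<bullet> d
        + (wave \<epsilon> c x \<bullet> wave' \<epsilon> c x) * (wave \<epsilon> c x \<bullet> d + wave' \<epsilon> c x \<bullet> \<phi> x)) (at x)"
proof -
  let ?b = "(2 - c\<^sup>2) / 2"
  let ?q = "\<lambda>x. ?b / sqrt 2 * (sin (x / sqrt 2) * cos (x / sqrt 2))"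
  let ?n = "1 - (norm (wave \<epsilon> c x))\<^sup>2"
  have "(?q has_real_derivative ?b / 2 * (cos (x / sqrt 2) * cos (x / sqrt 2) - sin (x / sqrt 2) * sin (x / sqrt 2))) (at x)"
    by (auto intro!: derivative_eq_intros simp: field_simps sqrt2_mult)
  also have "?b / 2 * (cos (x / sqrt 2) * cos (x / sqrt 2) - sin (x / sqrt 2) * sin (x / sqrt 2)) = ?n - ?b / 2"
    unfolding norm_wave[OF assms(1)] power2_eq_square[symmetric]
    by (simp add: sin_squared_eq field_simps)
  finally have q: "((\<lambda>x. wave \<epsilon> c x \<bullet> wave' \<epsilon> c x) has_vector_derivative ?n - ?b / 2) (at x)"
    unfolding inner_wave_wave'[OF assms(1)] by (simp add: has_real_derivative_iff_has_vector_derivative)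
  have ip: "((\<lambda>x. f x \<bullet> \<phi> x) has_vector_derivative f x \<bullet> d + f' \<bullet> \<phi> x) (at x)"
    if "(f has_vector_derivative f') (at x)" for f f'
    using bounded_bilinear.has_vector_derivative[OF bounded_bilinear_inner that \<phi>] by simp
  \<comment> \<open>The bracket on the right is the second derivative of the wave, and the scalar is
    the derivative from \<open>q\<close>.\<close>
  have lin: "(\<i> * of_real c * wave' \<epsilon> c x + wave \<epsilon> c x * of_real ?n)
     = - (- (\<i> * of_real c * wave' \<epsilon> c x) - of_real ((2 - c\<^sup>2) / 4) * wave \<epsilon> c x)
       + (?n - ?b / 2) *\<^sub>R wave \<epsilon> c x"
    by (simp add: scaleR_conv_of_real algebra_simps)
  show ?thesis
    unfolding lin
    by (rule has_vector_derivative_diff[OF has_vector_derivative_mult[OF q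
          ip[OF wave_has_vector_derivative]] ip[OF wave'_has_vector_derivative],
          THEN has_vector_derivative_eq_rhs])
      (unfold inner_add_left inner_minus_left inner_scaleR_left, linarith)
qed

subsection \<open>The phase\<close>

text \<open>The set of disagreement is open, and a nonempty open set of reals is not countable. This
  covers the points \<open>k * sqrt 2 * pi\<close>, where the phase formula prescribes
  nothing.\<close>

lemma continuous_eq_off_countable:
  fixes f g :: "real \<Rightarrow> 'a::real_normed_vector"
  assumes f: "continuous_on S f" and g: "continuous_on S g" and S: "open S" and T: "countable T"
    and eq: "\<And>x. x \<in> S \<Longrightarrow> x \<notin> T \<Longrightarrow> f x = g x" and x: "x \<in> S"
  shows "f x = g x"
proof (rule ccontr)
  let ?A = "S \<inter> (\<lambda>x. f x - g x) -` (- {0})"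
  assume "f x \<noteq> g x"
  with x have "?A \<noteq> {}" by auto
  moreover have "open ?A"
    by (rule continuous_open_preimage[OF continuous_on_diff[OF f g] S]) auto
  ultimately obtain y where "y \<in> ?A" "y \<notin> T"
    using open_minus_countable[OF T] by metis
  then show False using eq[of y] by auto
qed

lemma int_interval_times_pi:
  assumes "sin s \<noteq> 0"
  obtains k :: int where "of_int k * pi < s" "s < (of_int k + 1) * pi"
proof
  let ?k = "\<lfloor>s / pi\<rfloor>"
  have "of_int ?k * pi \<le> s"
    by (simp flip: pos_le_divide_eq)
  moreover have "of_int ?k * pi \<noteq> s"
  proof
    assume *: "of_int ?k * pi = s"
    have "sin (pi * of_int ?k) = 0" by (rule sin_npi_int)
    then have "sin s = 0" using * by (simp only: mult.commute[of pi])
    with assms show False by simp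
  qed
  ultimately show "of_int ?k * pi < s" by simp
  show "s < (of_int ?k + 1) * pi"
    by (simp flip: pos_divide_less_eq)
qed

text \<open>Recording the square gives invertibility of the sign without a parity split of
  \<open>k\<close>.\<close>

lemma cos_int_pi_squared: "cos (of_int k * pi) * cos (of_int k * pi) = (1::real)"
  using sin_cos_squared_add[of "of_int k * pi :: real"] sin_npi_int[of k]
  by (simp add: power2_eq_square mult.commute)

lemma cot_add_int_pi: "cot (t + of_int k * pi) = cot (t::real)"
proof -
  have "cos (of_int k * pi) \<noteq> (0::real)"
    using cos_int_pi_squared[of k] by auto
  then show ?thesis
    using sin_npi_int[of k] by (simp add: cot_def sin_add cos_add mult.commute)
qed

text \<open>Used with \<open>a = c / sqrt 2\<close> and \<open>b = c * y / 2\<close>. The shift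
  \<open>t\<close> lies in (0, pi), so \<open>sin t > 0\<close>, while \<open>\<sigma>\<close>
  carries the sign of \<open>sin s\<close>. The modulus is \<open>sin t * ?r\<close>, and
  \<open>?r\<close> cancels the denominators in the cosine and sine of the arctangent.\<close>

lemma phase_formula:
  assumes k: "of_int k * pi < s" "s < (of_int k + 1) * pi"
  shows "of_real (sqrt (1 - (1 - a\<^sup>2) * (cos s)\<^sup>2)) *
      exp (\<i> * of_real (pi / 2 + of_int k * pi - b - arctan (a * cot s))) =
    exp (- (\<i> * of_real b)) * Complex (a * cos s) (sin s)"
proof -
  define \<sigma> :: real where "\<sigma> = cos (of_int k * pi)"
  define t where "t = s - of_int k * pi"
  have sin0: "sin (of_int k * pi) = (0::real)"
    using sin_npi_int[of k] by (simp add: mult.commute)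
  have \<sigma>: "\<sigma> * \<sigma> = 1"
    unfolding \<sigma>_def by (rule cos_int_pi_squared)
  have s: "s = t + of_int k * pi" by (simp add: t_def)
  have "0 < t" "t < pi" using k by (auto simp: t_def algebra_simps)
  then have t: "sin t > 0" by (rule sin_gt_zero)
  have ss: "sin s = \<sigma> * sin t"
    unfolding s sin_add sin0 \<sigma>_def by simp
  with t \<sigma> have s0: "sin s \<noteq> 0" by auto
  let ?r = "sqrt (1 + (a * cot s)\<^sup>2)"
  have r: "?r > 0" by (simp add: add_pos_nonneg)
  have "sqrt (1 - (1 - a\<^sup>2) * (cos s)\<^sup>2) = sqrt ((sin t)\<^sup>2 * (1 + (a * cot s)\<^sup>2))"
  proof -
    have "(sin t)\<^sup>2 = (sin s)\<^sup>2"
      unfolding ss using \<sigma> by (simp add: power_mult_distrib power2_eq_square)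
    then have "(sin t)\<^sup>2 * (1 + (a * cot s)\<^sup>2) = (sin s)\<^sup>2 + a\<^sup>2 * (cos s)\<^sup>2"
      using s0 by (simp add: cot_def field_simps)
    then show ?thesis
      by (simp add: sin_squared_eq algebra_simps)
  qed
  also have "\<dots> = sin t * ?r"
    using t by (simp add: real_sqrt_mult)
  finally have mod: "sqrt (1 - (1 - a\<^sup>2) * (cos s)\<^sup>2) = sin t * ?r" .
  have "exp (\<i> * of_real (pi / 2 + of_int k * pi - b - arctan (a * cot s))) =
      cis (pi / 2) * cis (of_int k * pi) * cis (- arctan (a * cot s)) * cis (- b)"
    unfolding cis_conv_exp[symmetric] cis_mult by (simp add: algebra_simps)
  also have "cis (pi / 2) = \<i>" by simp
  also have "cis (of_int k * pi) = of_real \<sigma>"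
    unfolding complex_eq_iff using sin0 by (simp add: \<sigma>_def)
  also have "cis (- arctan (a * cot s)) = Complex (1 / ?r) (- (a * cot s / ?r))"
    unfolding complex_eq_iff by (simp add: cos_arctan sin_arctan)
  finally have "of_real (sqrt (1 - (1 - a\<^sup>2) * (cos s)\<^sup>2)) *
      exp (\<i> * of_real (pi / 2 + of_int k * pi - b - arctan (a * cot s))) =
      of_real (\<sigma> * sin t) * (\<i> * (of_real ?r * Complex (1 / ?r) (- (a * cot s / ?r)))) * cis (- b)"
    unfolding mod by (simp add: mult_ac)
  also have "of_real ?r * Complex (1 / ?r) (- (a * cot s / ?r)) = Complex 1 (- (a * cot s))"
    unfolding complex_eq_iff using r by simp
  also have "of_real (\<sigma> * sin t) * (\<i> * Complex 1 (- (a * cot s))) = Complex (a * cos s) (sin s)"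
    unfolding ss[symmetric] complex_eq_iff using s0 by (simp add: cot_def)
  finally show ?thesis
    by (simp add: cis_conv_exp mult.commute)
qed

text \<open>Rotating \<open>a cos s + \<i> sin s\<close> by \<open>-s\<close> keeps it in the right half plane, where its argument
  is an arctangent; this gives the phase without singularities.\<close>

lemma arctan_cot_unwrapped:
  assumes a: "a > 0" and k: "of_int k * pi < s" "s < (of_int k + 1) * pi"
  shows "s + arctan ((1 - a) * (sin s * cos s) / ((sin s)\<^sup>2 + a * (cos s)\<^sup>2)) =
    pi / 2 + of_int k * pi - arctan (a * cot s)"
proof -
  define t where "t = s - of_int k * pi"
  have s: "s = t + of_int k * pi" by (simp add: t_def)
  have t: "0 < t" "t < pi" using k by (auto simp: t_def algebra_simps)
  have s0: "sin s \<noteq> 0"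
  proof -
    have "sin s = sin t * cos (of_int k * pi)"
      using sin_npi_int[of k] unfolding s by (simp add: sin_add mult.commute)
    then show ?thesis
      using sin_gt_zero[OF t] cos_int_pi_squared[of k] by auto
  qed
  \<comment> \<open>After substituting \<open>s = t + of_int k * pi\<close>, the new arctangent has
    to equal \<open>arctan (cot s) - arctan (a * cot s)\<close>; this evaluates the first
    term.\<close>
  have "arctan (cot s) = pi / 2 - t"
    unfolding s cot_add_int_pi
    using t by (intro arctan_unique) (auto simp: tan_def cot_def sin_diff cos_diff)
  moreover have "arctan (cot s) + arctan (- (a * cot s)) =
      arctan ((cot s + - (a * cot s)) / (1 - cot s * - (a * cot s)))"
  \<comment> \<open>The addition formula requires the sum to stay within pi / 2. Since
    \<open>a > 0\<close>, the two arctangents being subtracted have the same sign, which ensures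
    this.\<close>
  proof (rule arctan_add_raw)
    have "\<bar>x - y\<bar> < pi / 2" if "(0 \<le> x \<and> 0 \<le> y) \<or> (x \<le> 0 \<and> y \<le> 0)"
      "- (pi / 2) < x" "x < pi / 2" "- (pi / 2) < y" "y < pi / 2" for x y :: real
      using that by linarith
    moreover have "(0 \<le> arctan (cot s) \<and> 0 \<le> arctan (a * cot s)) \<or>
        (arctan (cot s) \<le> 0 \<and> arctan (a * cot s) \<le> 0)"
      using a by (simp add: zero_le_mult_iff mult_le_0_iff) linarith
    ultimately show "\<bar>arctan (cot s) + arctan (- (a * cot s))\<bar> < pi / 2"
      using arctan_bounded[of "cot s"] arctan_bounded[of "a * cot s"]
      by (simp add: arctan_minus)
  qed
  moreover have "(cot s + - (a * cot s)) / (1 - cot s * - (a * cot s)) =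
      (1 - a) * (sin s * cos s) / ((sin s)\<^sup>2 + a * (cos s)\<^sup>2)"
  proof -
    have "(sin s)\<^sup>2 + a * (cos s)\<^sup>2 > 0" "1 + a * (cot s)\<^sup>2 > 0"
      using s0 a by (simp_all add: add_pos_nonneg)
    then show ?thesis
      using s0 by (simp add: cot_def power2_eq_square divide_simps) (simp add: algebra_simps)
  qed
  ultimately show ?thesis
    by (simp add: s arctan_minus)
qed

lemma scaled_interval:
  "y \<in> {of_int k * sqrt 2 * pi <..< (of_int k + 1) * sqrt 2 * pi} \<longleftrightarrow>
    of_int k * pi < y / sqrt 2 \<and> y / sqrt 2 < (of_int k + 1) * pi"
  by (simp add: field_simps)

lemma is_phase_exists:
  assumes c: "c > 0"
  shows "\<exists>\<theta>. is_phase c j \<theta>"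
proof -
  define a where "a = c / sqrt 2"
  have a: "a > 0" using c by (simp add: a_def)
  \<comment> \<open>The unwrapped argument minus the carrier phase; its denominator never vanishes
    because \<open>a > 0\<close>.\<close>
  define \<theta> where "\<theta> y = (y / sqrt 2 + arctan ((1 - a) * (sin (y / sqrt 2) * cos (y / sqrt 2)) /
      ((sin (y / sqrt 2))\<^sup>2 + a * (cos (y / sqrt 2))\<^sup>2))) - c * y / 2" for y
  have pos: "(sin s)\<^sup>2 + a * (cos s)\<^sup>2 \<noteq> 0" for s :: real
  proof
    assume "(sin s)\<^sup>2 + a * (cos s)\<^sup>2 = 0"
    then have "(sin s)\<^sup>2 = 0 \<and> a * (cos s)\<^sup>2 = 0"
      using a by (subst (asm) add_nonneg_eq_0_iff) auto
    then show False
      using a sin_cos_squared_add[of s] by simp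
  qed
  have "continuous_on (I j) \<theta>"
    unfolding \<theta>_def by (intro continuous_intros) (use pos in auto)
  moreover have "\<theta> y = pi / 2 + of_int k * pi - c * y / 2 - arctan (c / sqrt 2 * cot (y / sqrt 2))"
    if "y \<in> {of_int k * sqrt 2 * pi <..< (of_int k + 1) * sqrt 2 * pi} \<inter> I j" for k :: int and y
    using arctan_cot_unwrapped[OF a, of k "y / sqrt 2"] that
    unfolding Int_iff scaled_interval \<theta>_def a_def by linarith
  ultimately show ?thesis
    unfolding is_phase_def by blast
qed

lemma countable_sin_zero: "countable {x. sin (x / sqrt 2) = 0}"
proof (rule countable_subset)
  show "{x. sin (x / sqrt 2) = 0} \<subseteq> range (\<lambda>k::int. of_int k * pi * sqrt 2)"
    by (auto simp: sin_zero_iff_int2 field_simps)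
qed simp

lemma polar_form_eq_wave:
  assumes \<theta>: "is_phase c j \<theta>" and x: "x \<in> I j"
  shows "of_real (sqrt (1 - (2 - c\<^sup>2) / 2 * (cos (x / sqrt 2))\<^sup>2)) * exp (\<i> * of_real (\<theta> x)) =
    wave 1 c x"
\<comment> \<open>Both sides are continuous, so they need comparing only off the zeros of the sine,
  where \<open>is_phase\<close> prescribes \<open>\<theta>\<close>.\<close>
proof (rule continuous_eq_off_countable[OF _ continuous_on_wave _ countable_sin_zero _ x])
  have "continuous_on (I j) \<theta>" using \<theta> by (simp add: is_phase_def)
  then show "continuous_on (I j) (\<lambda>x. of_real (sqrt (1 - (2 - c\<^sup>2) / 2 * (cos (x / sqrt 2))\<^sup>2)) *
      exp (\<i> * of_real (\<theta> x)))"
    by (intro continuous_intros) auto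
  show "open (I j)" by (simp add: I_def)
  fix y assume y: "y \<in> I j" "y \<notin> {x. sin (x / sqrt 2) = 0}"
  then obtain k :: int where k: "of_int k * pi < y / sqrt 2" "y / sqrt 2 < (of_int k + 1) * pi"
    using int_interval_times_pi by blast
  then have "\<theta> y = pi / 2 + of_int k * pi - c * y / 2 - arctan (c / sqrt 2 * cot (y / sqrt 2))"
    using \<theta> y(1) unfolding is_phase_def by (metis IntI scaled_interval)
  moreover have "(2 - c\<^sup>2) / 2 = 1 - (c / sqrt 2)\<^sup>2"
    by (simp add: power_divide field_simps)
  ultimately show "of_real (sqrt (1 - (2 - c\<^sup>2) / 2 * (cos (y / sqrt 2))\<^sup>2)) *
      exp (\<i> * of_real (\<theta> y)) = wave 1 c y"
    using phase_formula[OF k, of "c / sqrt 2" "c * y / 2"] by (simp only: wave_def mult_1_left)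
qed

section \<open>Constancy on the components outside an open interval\<close>

lemma constant_on_components_of_compl_interval:
  fixes R :: real
  assumes R: "R > 0"
  shows "(\<forall>S \<in> components (- {-R<..<R}). u constant_on S) \<longleftrightarrow>
    (\<forall>x \<le> -R. u x = u (-R)) \<and> (\<forall>x \<ge> R. u x = u R)" (is "?lhs \<longleftrightarrow> ?rhs")
proof
  assume L: ?lhs
  \<comment> \<open>The components need not be computed: each closed ray is connected and therefore
    lies inside a single component.\<close>
  have const: "u x = u y" if T: "T \<subseteq> - {-R<..<R}" "connected T" "x \<in> T" "y \<in> T" for T x y
  proof -
    have "- {-R<..<R} \<noteq> {}"
      using T(1,3) by (metis empty_iff subsetD)
    then obtain C where C: "C \<in> components (- {-R<..<R})" "T \<subseteq> C"
      using exists_component_superset[OF T(1) _ T(2)] by metis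
    then have "u constant_on C"
      using L by (metis bspec)
    then show ?thesis
      using C(2) T(3,4) unfolding constant_on_def by (metis subsetD)
  qed
  show ?rhs
  proof (intro conjI allI impI)
    show "u x = u (-R)" if "x \<le> -R" for x
      by (rule const[of "{..-R}"]) (use that R in \<open>auto simp: connected_Iic connected_Ici\<close>)
    show "u x = u R" if "x \<ge> R" for x
      by (rule const[of "{R..}"]) (use that R in \<open>auto simp: connected_Iic connected_Ici\<close>)
  qed
next
  assume Rhs: ?rhs
  show ?lhs
  proof
    fix S assume S: "S \<in> components (- {-R<..<R})"
    then have sub: "S \<subseteq> - {-R<..<R}" and con: "connected S"
      by (auto dest: in_components_subset in_components_connected)
    \<comment> \<open>A component meeting both rays would, being connected, contain 0.\<close>
    have "S \<subseteq> {..-R} \<or> S \<subseteq> {R..}"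
    proof (rule ccontr)
      assume "\<not> ?thesis"
      then obtain x y where xy: "x \<in> S" "\<not> x \<le> -R" "y \<in> S" "\<not> y \<ge> R"
        by (auto simp: subset_iff)
      moreover have "x \<ge> R" "y \<le> -R"
        using subsetD[OF sub xy(1)] subsetD[OF sub xy(3)] xy(2,4) by auto
      ultimately have "0 \<in> S"
        using R by (intro connectedD_interval[OF con xy(3,1)]) auto
      with subsetD[OF sub this] R show False by simp
    qed
    then show "u constant_on S"
    proof
      assume "S \<subseteq> {..-R}"
      then have "u x = u (-R)" if "x \<in> S" for x using Rhs that by blast
      then show ?thesis unfolding constant_on_def by (intro exI ballI)
    next
      assume "S \<subseteq> {R..}"
      then have "u x = u R" if "x \<in> S" for x using Rhs that by blast
      then show ?thesis unfolding constant_on_def by (intro exI ballI)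
    qed
  qed
qed

subsection \<open>The profile\<close>

definition end_pt :: "nat \<Rightarrow> real" where
  "end_pt j = real j * pi / sqrt 2"

lemma I_eq: "I j = {- end_pt j <..< end_pt j}"
  by (simp add: I_def end_pt_def)

lemma end_pt_pos: "j \<ge> 1 \<Longrightarrow> end_pt j > 0"
  by (simp add: end_pt_def)

text \<open>Rescaling turns the end points into odd multiples of pi / 2; this is where the parity of
  \<open>j\<close> enters.\<close>

lemma cos_end_pt:
  assumes "odd j"
  shows "cos (end_pt j / sqrt 2) = 0" "cos (- end_pt j / sqrt 2) = 0"
proof -
  have "end_pt j / sqrt 2 = real j * (pi / 2)"
    by (simp add: end_pt_def)
  moreover have "cos (real j * (pi / 2)) = 0"
    unfolding cos_zero_iff using assms by blast
  ultimately show "cos (end_pt j / sqrt 2) = 0"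
    by (simp only:)
  then show "cos (- end_pt j / sqrt 2) = 0"
    by simp
qed

text \<open>At speed 0 the closed form is \<open>\<epsilon> * \<i>\<close> times the sine, so the
  phase \<open>-\<i>\<close> recovers the real sine.\<close>

lemma wave_speed_zero: "wave (- \<i>) 0 x = of_real (sin (x / sqrt 2))"
  by (simp add: wave_def complex_eq_iff)

lemma profile_eq_wave:
  assumes c: "c \<ge> 0" and j: "j \<ge> 1"
  shows "profile c j = (\<lambda>x. wave (if c = 0 then - \<i> else 1) c (clamp_to (end_pt j) x))"
    (is "_ = ?u")
  unfolding profile_def
proof (rule the_equality)
  let ?\<epsilon> = "if c = 0 then - \<i> else 1" and ?R = "end_pt j"
  have R: "?R > 0" using end_pt_pos[OF j] .
  have u: "?u x = wave ?\<epsilon> c x" if "x \<in> I j" for x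
    using that by (simp add: I_eq)
  show "is_profile c j ?u"
    unfolding is_profile_def
  proof (intro conjI)
    show "if c = 0 then \<forall>x \<in> I j. ?u x = of_real (sin (x / sqrt 2))
      else \<exists>\<theta>. is_phase c j \<theta> \<and>
        (\<forall>x \<in> I j. ?u x = of_real (sqrt (1 - (2 - c\<^sup>2) / 2 * (cos (x / sqrt 2))\<^sup>2))
                           * exp (\<i> * of_real (\<theta> x)))"
    proof (cases "c = 0")
      case True
      then show ?thesis using u wave_speed_zero by simp
    next
      case False
      then obtain \<theta> where "is_phase c j \<theta>" using is_phase_exists c by force
      then show ?thesis using u polar_form_eq_wave False by auto
    qed
    show "continuous_on UNIV ?u"
      by (rule continuous_on_compose2[OF continuous_on_wave[of UNIV] continuous_on_clamp_to]) simp
    show "\<forall>S \<in> components (- I j). ?u constant_on S"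
      unfolding I_eq constant_on_components_of_compl_interval[OF R]
      using R by (simp add: clamp_to_left clamp_to_right)
  qed
  fix v assume v: "is_profile c j v"
  have vI: "v x = wave ?\<epsilon> c x" if "x \<in> I j" for x
    using v that wave_speed_zero polar_form_eq_wave unfolding is_profile_def
    by (cases "c = 0") auto
  have vc: "v x = wave ?\<epsilon> c x" if "x \<in> {-?R..?R}" for x
  proof -
    have cv: "continuous_on {-?R..?R} v"
      using v continuous_on_subset by (auto simp: is_profile_def)
    have "{-?R..?R} = closure {-?R<..<?R}" using R by simp
    then have "v x - wave ?\<epsilon> c x = 0"
      using continuous_constant_on_closure[of "{-?R<..<?R}" "\<lambda>x. v x - wave ?\<epsilon> c x" 0 x]
        continuous_on_diff[OF cv continuous_on_wave[of _ ?\<epsilon> c]] vI that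
      by (simp add: I_eq)
    then show ?thesis by simp
  qed
  have "\<forall>S \<in> components (- {-?R<..<?R}). v constant_on S"
    using v unfolding is_profile_def I_eq by (elim conjE)
  then have out: "(\<forall>x \<le> -?R. v x = v (-?R)) \<and> (\<forall>x \<ge> ?R. v x = v ?R)"
    unfolding constant_on_components_of_compl_interval[OF R] .
  show "v = ?u"
  proof
    fix x
    consider "x \<in> {-?R..?R}" | "x \<le> -?R" | "x \<ge> ?R" by (meson atLeastAtMost_iff linear)
    then show "v x = ?u x"
    proof cases
      case 1
      then show ?thesis using vc by simp
    next
      case 2
      then have "v x = v (-?R)" using out by blast
      also have "\<dots> = wave ?\<epsilon> c (-?R)" using vc R by simp
      finally show ?thesis using 2 R by (simp add: clamp_to_left)
    next
      case 3
      then have "v x = v ?R" using out by blast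
      also have "\<dots> = wave ?\<epsilon> c ?R" using vc R by simp
      finally show ?thesis using 3 R by (simp add: clamp_to_right)
    qed
  qed
qed

section \<open>Vanishing outside the interval, finite energy and the weak equation\<close>

lemma wave_clamp_to_end:
  assumes "odd j" "x \<notin> {- end_pt j..end_pt j}"
  shows "wave' \<epsilon> c (clamp_to (end_pt j) x) = 0" "cos (clamp_to (end_pt j) x / sqrt 2) = 0"
proof -
  have "j \<ge> 1" using assms(1) by (cases j) auto
  then have "clamp_to (end_pt j) x = end_pt j \<or> clamp_to (end_pt j) x = - end_pt j"
    using assms(2) end_pt_pos[of j] by (auto simp: clamp_to_def)
  then show *: "cos (clamp_to (end_pt j) x / sqrt 2) = 0"
    using cos_end_pt[OF assms(1)] by auto
  then show "wave' \<epsilon> c (clamp_to (end_pt j) x) = 0"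
    by (simp add: wave'_def complex_eq_iff)
qed

theorem proposition1p9:
  fixes c :: real and j :: nat
  assumes "c \<ge> 0" and "c \<noteq> sqrt 2"
    and "j \<ge> 1" and "odd j"
  shows "profile c j \<in> energy_space \<and> weak_solution_TW c (1/2) (profile c j)"
proof -
  define \<epsilon> :: complex where "\<epsilon> = (if c = 0 then - \<i> else 1)"
  have \<epsilon>: "norm \<epsilon> = 1" by (simp add: \<epsilon>_def)
  let ?R = "end_pt j" and ?cl = "clamp_to (end_pt j)"
  define u where "u x = wave \<epsilon> c (?cl x)" for x
  define u' where "u' x = wave' \<epsilon> c (?cl x)" for x
  have profile: "profile c j = u"
    unfolding u_def \<epsilon>_def using profile_eq_wave[OF assms(1,3)] .
  have R: "?R > 0" using end_pt_pos[OF assms(3)] .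
  have w0: "wave' \<epsilon> c ?R = 0" "wave' \<epsilon> c (- ?R) = 0"
    using cos_end_pt[OF assms(4)] by (simp_all add: wave'_def complex_eq_iff)
  have du: "(u has_vector_derivative u' x) (at x)" for x
    unfolding u_def u'_def
    by (rule has_vector_derivative_clamp_to[OF _ wave_has_vector_derivative w0]) (use R in simp)
  have cont: "continuous_on S u" "continuous_on S u'" for S
    unfolding u_def u'_def
    by (auto intro: continuous_on_compose2[where t = UNIV] continuous_on_wave continuous_on_wave'
        continuous_on_clamp_to)
  have wd: "has_weak_derivative u u'"
    by (rule has_weak_derivative_C1[OF du cont(2)])
  have zero: "u' x = 0" "1 - (norm (u x))\<^sup>2 = 0" if "x \<notin> {-?R..?R}" for x
    using wave_clamp_to_end[OF assms(4) that] by (simp_all add: u_def u'_def norm_wave[OF \<epsilon>])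
  \<comment> \<open>Finite energy follows from continuity and compact support of
    \<open>1 - (norm (u x))^2\<close> and of \<open>u'\<close>.\<close>
  have "square_integrable (\<lambda>x. 1 - (norm (u x))\<^sup>2)"
    by (rule square_integrable_continuous_compact_support[OF _ compact_Icc zero(2)])
      (intro continuous_intros cont)
  moreover have "square_integrable u'"
    by (rule square_integrable_continuous_compact_support[OF cont(2) compact_Icc zero(1)])
  ultimately have energy: "u \<in> energy_space"
    using wd locally_square_integrable_continuous[OF cont(1)]
      locally_square_integrable_continuous[OF cont(2)]
    unfolding energy_space_def H1_loc_def by blast
  have "\<exists>d. has_weak_derivative (\<lambda>x. u x \<bullet> \<phi> x) d \<and>
      has_bochner_integral lebesgue
        (\<lambda>x. (\<i> * of_real c * u' x + u x * of_real (1 - (norm (u x))\<^sup>2)) \<bullet> \<phi> x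
             - u' x \<bullet> vector_derivative \<phi> (at x)
             + 2 * (1 / 2) * (u x \<bullet> u' x) * d x) 0"
    if tf: "test_function \<phi>" for \<phi>
  proof (intro exI conjI)
    note d\<phi> = test_function_has_vector_derivative[OF tf]
    note c\<phi> = test_function_continuous[OF tf] test_function_continuous_derivative[OF tf]
    let ?\<phi>' = "\<lambda>x. vector_derivative \<phi> (at x)"
    let ?d = "\<lambda>x. u x \<bullet> ?\<phi>' x + u' x \<bullet> \<phi> x"
    have "((\<lambda>x. u x \<bullet> \<phi> x) has_vector_derivative ?d x) (at x)" for x
      using bounded_bilinear.has_vector_derivative[OF bounded_bilinear_inner du d\<phi>] .
    then show "has_weak_derivative (\<lambda>x. u x \<bullet> \<phi> x) ?d"
      by (rule has_weak_derivative_C1) (intro continuous_intros cont c\<phi>)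
    \<comment> \<open>The integrand is abstracted over the function pair, so that it can be read for
      the wave on the interval and for \<open>u\<close> on the whole line.\<close>
    let ?G = "\<lambda>u u' x. (\<i> * of_real c * u' x + u x * of_real (1 - (norm (u x))\<^sup>2)) \<bullet> \<phi> x
        - u' x \<bullet> ?\<phi>' x + (u x \<bullet> u' x) * (u x \<bullet> ?\<phi>' x + u' x \<bullet> \<phi> x)"
    let ?F = "\<lambda>x. (wave \<epsilon> c x \<bullet> wave' \<epsilon> c x) * (wave \<epsilon> c x \<bullet> \<phi> x) - wave' \<epsilon> c x \<bullet> \<phi> x"
    have "has_bochner_integral lebesgue
        (\<lambda>x. indicator {-?R..?R} x *\<^sub>R ?G (wave \<epsilon> c) (wave' \<epsilon> c) x) (?F ?R - ?F (-?R))"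
    proof (rule has_bochner_integral_lebesgue_FTC_Icc)
      show "- ?R \<le> ?R" using R by simp
      show "(?F has_vector_derivative ?G (wave \<epsilon> c) (wave' \<epsilon> c) x) (at x)" for x
        by (rule flux_has_vector_derivative[OF \<epsilon> d\<phi>])
      show "continuous_on {-?R..?R} (?G (wave \<epsilon> c) (wave' \<epsilon> c))"
        by (intro continuous_intros continuous_on_wave continuous_on_wave' c\<phi>)
    qed
    \<comment> \<open>Both terms of the flux contain \<open>wave'\<close>, so it vanishes at the
      ends whatever values \<open>\<phi>\<close> takes there.\<close>
    also have "?F ?R - ?F (-?R) = 0"
      by (simp add: w0)
    \<comment> \<open>Every summand of the integrand for \<open>u\<close> carries a factor
      \<open>u'\<close> or \<open>1 - (norm (u x))^2\<close>, and both are zero off the closed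
      interval.\<close>
    also have "(\<lambda>x. indicator {-?R..?R} x *\<^sub>R ?G (wave \<epsilon> c) (wave' \<epsilon> c) x) = ?G u u'"
    proof
      show "indicator {-?R..?R} x *\<^sub>R ?G (wave \<epsilon> c) (wave' \<epsilon> c) x = ?G u u' x" for x
      proof (cases "x \<in> {-?R..?R}")
        case True
        then have "u x = wave \<epsilon> c x" "u' x = wave' \<epsilon> c x"
          by (simp_all add: u_def u'_def)
        with True show ?thesis by simp
      next
        case False
        then show ?thesis by (simp only: zero[OF False]) simp
      qed
    qed
    finally show "has_bochner_integral lebesgue
        (\<lambda>x. (\<i> * of_real c * u' x + u x * of_real (1 - (norm (u x))\<^sup>2)) \<bullet> \<phi> x
             - u' x \<bullet> vector_derivative \<phi> (at x)
             + 2 * (1 / 2) * (u x \<bullet> u' x) * ?d x) 0"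
      by simp
  qed
  with energy wd show ?thesis
    unfolding profile weak_solution_TW_def by blast
qed

end
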